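(* Let $f:\mathbb{D}^2\to\mathbb{D}$ be a holomorphic function which is everywhere infinitesimally extremal and which extends continuously to the closed bidisk $\overline{\mathbb{D}}\times\overline{\mathbb{D}}$. Then $f$ depends on only one variable and is an automorphism of the disk in that variable; that is, there is a (holomorphic) automorphism $\phi$ of $\mathbb{D}$ such that either $f(z,w)=\phi(z)$ for all $(z,w)\in\mathbb{D}^2$, or $f(z,w)=\phi(w)$ for all $(z,w)\in\mathbb{D}^2$.
   Context: $\mathbb{D}=\{\zeta\in\mathbb{C}:|\zeta|<1\}$ is the open unit disk and $\mathbb{D}^2=\mathbb{D}\times\mathbb{D}$ is the bidisk. A holomorphic function $f:\mathbb{D}^2\to\mathbb{D}$ is called everywhere infinitesimally extremal if $$(1-|z|^2)\left|\frac{\partial f}{\partial z}(z,w)\right|+(1-|w|^2)\left|\frac{\partial f}{\partial w}(z,w)\right|=1-|f(z,w)|^2$$ for every $(z,w)\in\mathbb{D}^2$. *)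

theory Defs
  imports "HOL-Complex_Analysis.Complex_Analysis"
begin

abbreviation unit_disk :: "complex set" where
  "unit_disk \<equiv> ball 0 1"

abbreviation bidisk :: "(complex \<times> complex) set" where
  "bidisk \<equiv> unit_disk \<times> unit_disk"

text \<open>
  Holomorphy in two variables is meant on open sets: total differentiability with a
  complex-linear derivative.
\<close>

definition holomorphic2_on ::
    "(complex \<times> complex \<Rightarrow> complex) \<Rightarrow> (complex \<times> complex) set \<Rightarrow> bool"
    (infixl "holomorphic2'_on" 50) where
  "f holomorphic2_on S \<longleftrightarrow>
     (\<forall>p\<in>S. \<exists>a b. (f has_derivative (\<lambda>h. a * fst h + b * snd h)) (at p within S))"

definition partial_z :: "(complex \<times> complex \<Rightarrow> complex) \<Rightarrow> complex \<Rightarrow> complex \<Rightarrow> complex" where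
  "partial_z f z w = deriv (\<lambda>\<zeta>. f (\<zeta>, w)) z"

definition partial_w :: "(complex \<times> complex \<Rightarrow> complex) \<Rightarrow> complex \<Rightarrow> complex \<Rightarrow> complex" where
  "partial_w f z w = deriv (\<lambda>\<zeta>. f (z, \<zeta>)) w"

definition everywhere_inf_extremal :: "(complex \<times> complex \<Rightarrow> complex) \<Rightarrow> bool" where
  "everywhere_inf_extremal f \<longleftrightarrow>
     (\<forall>z\<in>unit_disk. \<forall>w\<in>unit_disk.
        (1 - (cmod z)\<^sup>2) * cmod (partial_z f z w) + (1 - (cmod w)\<^sup>2) * cmod (partial_w f z w)
          = 1 - (cmod (f (z, w)))\<^sup>2)"

definition disk_automorphism :: "(complex \<Rightarrow> complex) \<Rightarrow> bool" where
  "disk_automorphism \<phi> \<longleftrightarrow>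
     \<phi> holomorphic_on unit_disk \<and> bij_betw \<phi> unit_disk unit_disk \<and>
     inv_into unit_disk \<phi> holomorphic_on unit_disk"

end

theory Submission
  imports Defs
begin

text \<open>
  Let \<open>F\<close> be the continuous extension. For \<open>|\<tau>| = 1\<close> the Cauchy estimate gives
  \<open>(1 - |z|\<^sup>2) |\<partial>F/\<partial>z| \<longrightarrow> 0\<close> as \<open>z \<longrightarrow> \<tau>\<close>, so the slice \<open>F (\<tau>, _)\<close> inherits equality in the
  Schwarz--Pick inequality: it is an automorphism of the disk or a unimodular constant. Slices of
  the first kind attain both \<open>1\<close> and \<open>-1\<close> on the closed disk and slices of the second kind do not,
  so both kinds form closed sets of \<open>\<tau>\<close> and, the circle being connected, only one kind occurs. If
  all slices are constant, \<open>F\<close> depends on \<open>z\<close> only. The same applies with the variables exchanged,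
  and it remains to exclude that all slices in both directions are automorphisms. Extremality at
  \<open>(0, w)\<close> yields a point \<open>z\<close> with \<open>|z| = |w|\<close> such that \<open>F (0, w)\<close> and \<open>F (z, 0)\<close> have
  pseudo-hyperbolic distance \<open>|w|\<close>. As \<open>w \<longrightarrow> 1\<close> this distance tends to 1, although both values
  stay in a compact subset of the open disk.
\<close>

section \<open>Equality in the Schwarz--Pick inequality\<close>

lemma deriv_Moebius_function_self:
  assumes "cmod a < 1"
  shows "(Moebius_function 0 a has_field_derivative of_real (1 / (1 - (cmod a)\<^sup>2))) (at a)"
proof -
  have eq: "1 - cnj a * a = of_real (1 - (cmod a)\<^sup>2)"
    by (metis complex_norm_square mult.commute of_real_1 of_real_diff of_real_power)
  have "1 - (cmod a)\<^sup>2 \<noteq> 0"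
    using assms by (smt (verit) norm_ge_zero power2_eq_1_iff)
  then have nz: "1 - cnj a * a \<noteq> 0"
    unfolding eq of_real_eq_0_iff .
  have "((\<lambda>z. (z - a) / (1 - cnj a * z)) has_field_derivative 1 / (1 - cnj a * a)) (at a)"
    using nz by (auto intro!: derivative_eq_intros)
  then show ?thesis
    unfolding eq by (simp add: Moebius_function_simple[abs_def])
qed

text \<open>After composition with the Moebius map taking \<open>g 0\<close> to 0,
  \<open>ext\<close> says that the derivative at 0 has modulus 1, so the equality case of the
  Schwarz lemma makes the composite a rotation.\<close>

lemma Schwarz_Pick_rigidity:
  assumes hol: "g holomorphic_on unit_disk" and bd: "g ` unit_disk \<subseteq> unit_disk"
    and ext: "cmod (deriv g 0) = 1 - (cmod (g 0))\<^sup>2"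
  obtains c where "cmod c = 1" "\<And>z. z \<in> unit_disk \<Longrightarrow> Moebius_function 0 (g 0) (g z) = c * z"
proof -
  define a where "a = g 0"
  have a: "cmod a < 1"
    using bd by (force simp: a_def)
  have pos: "1 - (cmod a)\<^sup>2 > 0"
    using a by (simp add: abs_square_less_1)
  let ?h = "\<lambda>z. Moebius_function 0 a (g z)"
  have h: "?h holomorphic_on unit_disk"
    using holomorphic_on_compose_gen[OF hol Moebius_function_holomorphic[OF a] bd]
    by (simp add: o_def)
  have "(g has_field_derivative deriv g 0) (at 0)"
    using hol holomorphic_derivI by force
  then have "(?h has_field_derivative of_real (1 / (1 - (cmod a)\<^sup>2)) * deriv g 0) (at 0)"
    using deriv_Moebius_function_self[OF a] DERIV_chain2 unfolding a_def by blast
  then have "deriv ?h 0 = of_real (1 / (1 - (cmod a)\<^sup>2)) * deriv g 0"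
    by (rule DERIV_imp_deriv)
  also have "cmod \<dots> = (1 / (1 - (cmod a)\<^sup>2)) * (1 - (cmod a)\<^sup>2)"
    using pos ext unfolding norm_mult norm_of_real by (simp add: a_def)
  finally have "cmod (deriv ?h 0) = 1"
    using pos by simp
  then have "\<exists>c. (\<forall>z. cmod z < 1 \<longrightarrow> ?h z = c * z) \<and> cmod c = 1"
    using Schwarz_Lemma(3)[OF h, of 0] bd a Moebius_function_norm_lt_1[OF a]
    by (force simp: a_def Moebius_function_eq_zero image_subset_iff)
  then show thesis
    using that by (auto simp: a_def)
qed

text \<open>Rigidity writes \<open>g\<close> as a rotation followed by a Moebius map, so its inverse
  \<open>k\<close> is explicit and visibly holomorphic.\<close>

lemma disk_automorphismI:
  assumes hol: "g holomorphic_on unit_disk" and bd: "g ` unit_disk \<subseteq> unit_disk"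
    and ext: "cmod (deriv g 0) = 1 - (cmod (g 0))\<^sup>2"
  shows "disk_automorphism g"
proof -
  obtain c where c: "cmod c = 1"
    and eq: "\<And>z. z \<in> unit_disk \<Longrightarrow> Moebius_function 0 (g 0) (g z) = c * z"
    using Schwarz_Pick_rigidity[OF assms] by blast
  have a: "cmod (g 0) < 1"
    using bd by force
  have c0: "c \<noteq> 0"
    using c by force
  define k where "k = (\<lambda>y. Moebius_function 0 (g 0) y / c)"
  have kg: "k (g z) = z" if "z \<in> unit_disk" for z
    using eq[OF that] c0 by (simp add: k_def)
  have k: "k y \<in> unit_disk" if "y \<in> unit_disk" for y
    using Moebius_function_norm_lt_1[OF a] that c by (simp add: k_def norm_divide)
  have gk: "g (k y) = y" if y: "y \<in> unit_disk" for y
  proof -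
    \<comment> \<open>The Moebius map is injective on the disk, being inverted by the one for
      \<open>- g 0\<close>, so it suffices to compare images.\<close>
    have "Moebius_function 0 (g 0) (g (k y)) = Moebius_function 0 (g 0) y"
      using eq[OF k[OF y]] c0 by (simp add: k_def)
    moreover have "g (k y) \<in> unit_disk"
      using bd k[OF y] by blast
    ultimately show ?thesis
      using Moebius_function_compose[of "- g 0" "g 0"] a y by (metis mem_ball_0 minus_minus norm_minus_cancel)
  qed
  have bij: "bij_betw g unit_disk unit_disk"
    using kg gk k bd by (intro bij_betw_byWitness[where f' = k]) auto
  have "k holomorphic_on unit_disk"
    unfolding k_def using c0 by (intro holomorphic_intros Moebius_function_holomorphic a)
  moreover have "k y = inv_into unit_disk g y" if "y \<in> unit_disk" for y
    using bij gk[OF that] k[OF that] by (metis bij_betw_def inv_into_f_eq)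
  ultimately have "inv_into unit_disk g holomorphic_on unit_disk"
    using holomorphic_transform by blast
  with bij hol show ?thesis
    by (simp add: disk_automorphism_def)
qed

text \<open>The quotient of the two sides is the pseudo-hyperbolic distance of \<open>a\<close> and
  \<open>b\<close>, the modulus of a value of a Moebius self-map of the disk.\<close>

lemma pseudo_hyperbolic_lt_1:
  assumes "cmod a < 1" "cmod b < 1"
  shows "cmod (b - a) < cmod (1 - cnj a * b)"
proof -
  have "1 - cnj a * b \<noteq> 0"
    using assms norm_mult_less[of "cnj a" 1 b 1] by auto
  then show ?thesis
    using Moebius_function_norm_lt_1[OF assms, of 0]
    by (simp add: Moebius_function_simple norm_divide divide_simps)
qed

text \<open>Serves to turn both partial derivatives into nonnegative reals, so that nothing cancels
  in the chain rule.\<close>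

lemma unimodular_rotation:
  fixes u :: complex
  obtains c where "cmod c = 1" "c * u = of_real (cmod u)"
proof (cases "u = 0")
  case True
  then show ?thesis
    using that[of 1] by simp
next
  case False
  then show ?thesis
    using that[of "of_real (cmod u) / u"] by (simp add: norm_divide)
qed

section \<open>Extremal functions on the closed bidisk\<close>

text \<open>The parameter is the continuous extension itself, so that it can be evaluated at
  boundary points. The locale is interpreted again with the variables exchanged.\<close>

locale continuous_extremal =
  fixes F :: "complex \<times> complex \<Rightarrow> complex"
  assumes hol2: "F holomorphic2_on bidisk"
    and maps: "F ` bidisk \<subseteq> unit_disk"
    and extremal: "everywhere_inf_extremal F"
    and cont: "continuous_on (cball 0 1 \<times> cball 0 1) F"
begin

lemma extremal_eq:
  assumes "z \<in> unit_disk" "w \<in> unit_disk"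
  shows "(1 - (cmod z)\<^sup>2) * cmod (partial_z F z w) + (1 - (cmod w)\<^sup>2) * cmod (partial_w F z w)
    = 1 - (cmod (F (z, w)))\<^sup>2"
  using extremal assms unfolding everywhere_inf_extremal_def by blast

text \<open>Restriction to the coordinate lines identifies the coefficients of the total derivative.
  The total derivative is kept for differentiating along graphs.\<close>

lemma has_derivative_partials:
  assumes z: "z \<in> unit_disk" and w: "w \<in> unit_disk"
  shows "(F has_derivative (\<lambda>h. partial_z F z w * fst h + partial_w F z w * snd h)) (at (z, w))"
    and "((\<lambda>\<zeta>. F (\<zeta>, w)) has_field_derivative partial_z F z w) (at z)"
    and "((\<lambda>\<zeta>. F (z, \<zeta>)) has_field_derivative partial_w F z w) (at w)"
proof -
  have zw: "(z, w) \<in> bidisk"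
    using z w by simp
  have "at (z, w) within bidisk = at (z, w)"
    by (rule at_within_open[OF zw]) (intro open_Times open_ball)
  then obtain a b where ab: "(F has_derivative (\<lambda>h. a * fst h + b * snd h)) (at (z, w))"
    using bspec[OF hol2[unfolded holomorphic2_on_def] zw] by auto
  have "((\<lambda>\<zeta>. F (\<zeta>, w)) has_derivative (\<lambda>h. a * fst (h, 0::complex) + b * snd (h, 0::complex))) (at z)"
    by (rule has_derivative_compose[where f = "\<lambda>\<zeta>. (\<zeta>, w)", OF _ ab])
      (auto intro!: derivative_eq_intros)
  then have dz: "((\<lambda>\<zeta>. F (\<zeta>, w)) has_field_derivative a) (at z)"
    by (simp add: has_field_derivative_def)
  have "((\<lambda>\<zeta>. F (z, \<zeta>)) has_derivative (\<lambda>h. a * fst (0::complex, h) + b * snd (0::complex, h))) (at w)"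
    by (rule has_derivative_compose[where f = "\<lambda>\<zeta>. (z, \<zeta>)", OF _ ab])
      (auto intro!: derivative_eq_intros)
  then have dw: "((\<lambda>\<zeta>. F (z, \<zeta>)) has_field_derivative b) (at w)"
    by (simp add: has_field_derivative_def)
  have "a = partial_z F z w" "b = partial_w F z w"
    using dz dw by (simp_all add: partial_z_def partial_w_def DERIV_imp_deriv)
  with ab dz dw show "(F has_derivative (\<lambda>h. partial_z F z w * fst h + partial_w F z w * snd h)) (at (z, w))"
    "((\<lambda>\<zeta>. F (\<zeta>, w)) has_field_derivative partial_z F z w) (at z)"
    "((\<lambda>\<zeta>. F (z, \<zeta>)) has_field_derivative partial_w F z w) (at w)"
    by auto
qed

lemma holomorphic_fst:
  assumes "w \<in> unit_disk"
  shows "(\<lambda>\<zeta>. F (\<zeta>, w)) holomorphic_on unit_disk"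
  using has_derivative_partials(2)[OF _ assms] unfolding holomorphic_on_open[OF open_ball] by blast

lemma holomorphic_snd:
  assumes "z \<in> unit_disk"
  shows "(\<lambda>\<zeta>. F (z, \<zeta>)) holomorphic_on unit_disk"
  using has_derivative_partials(3)[OF assms] unfolding holomorphic_on_open[OF open_ball] by blast

lemma continuous_fst:
  assumes "w \<in> cball 0 1"
  shows "continuous_on (cball 0 1) (\<lambda>\<zeta>. F (\<zeta>, w))"
  using assms by (intro continuous_on_compose2[OF cont] continuous_intros) auto

lemma continuous_snd:
  assumes "z \<in> cball 0 1"
  shows "continuous_on (cball 0 1) (\<lambda>\<zeta>. F (z, \<zeta>))"
  using assms by (intro continuous_on_compose2[OF cont] continuous_intros) auto

lemma norm_le_1:
  assumes "z \<in> cball 0 1" "w \<in> cball 0 1"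
  shows "cmod (F (z, w)) \<le> 1"
proof -
  have "F ` closure bidisk \<subseteq> cball 0 1"
    using cont maps by (intro image_closure_subset)
      (auto simp: closure_Times image_subset_iff intro: less_imp_le)
  then show ?thesis
    using assms by (force simp: closure_Times)
qed

text \<open>
  By extremality at \<open>(0, w)\<close> the restriction of \<open>F\<close> to a suitable graph through \<open>(0, w)\<close> of an
  automorphism is itself an automorphism, hence preserves the pseudo-hyperbolic distance. The
  graph meets \<open>w = 0\<close> over a point \<open>z\<close> with \<open>|z| = |w|\<close>.
\<close>

lemma exists_isometric_pair:
  assumes w: "w \<in> unit_disk"
  obtains z where "cmod z = cmod w"
    "cmod (F (z, 0) - F (0, w)) = cmod w * cmod (1 - cnj (F (0, w)) * F (z, 0))"
proof -
  define p q where "p = partial_z F 0 w" and "q = partial_w F 0 w"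
  obtain \<alpha> where \<alpha>: "cmod \<alpha> = 1" "\<alpha> * p = of_real (cmod p)"
    using unimodular_rotation by blast
  obtain \<beta> where \<beta>: "cmod \<beta> = 1" "\<beta> * q = of_real (cmod q)"
    using unimodular_rotation by blast
  \<comment> \<open>This automorphism takes 0 to \<open>w\<close>, and its derivative at 0 has
    modulus \<open>1 - (cmod w)\<^sup>2\<close>, exactly the weight of the \<open>w\<close>-partial
    in the extremality equation.\<close>
  define \<psi> where "\<psi> \<zeta> = Moebius_function 0 (- w) (\<beta> * \<zeta>)" for \<zeta>
  have \<psi>0: "\<psi> 0 = w"
    by (simp add: \<psi>_def Moebius_function_of_zero)
  have \<psi>_in: "\<psi> \<zeta> \<in> unit_disk" if "\<zeta> \<in> unit_disk" for \<zeta>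
    using Moebius_function_norm_lt_1[of "- w" "\<beta> * \<zeta>"] w that \<beta> by (simp add: \<psi>_def norm_mult)
  have \<alpha>_in: "\<alpha> * \<zeta> \<in> unit_disk" if "\<zeta> \<in> unit_disk" for \<zeta>
    using that \<alpha> by (simp add: norm_mult)
  have \<psi>_hol: "\<psi> holomorphic_on unit_disk"
  proof -
    have "(Moebius_function 0 (- w) \<circ> (\<lambda>\<zeta>. \<beta> * \<zeta>)) holomorphic_on unit_disk"
      using w \<beta> by (intro holomorphic_on_compose_gen[OF _ Moebius_function_holomorphic])
        (auto intro!: holomorphic_intros simp: norm_mult)
    then show ?thesis
      by (simp add: \<psi>_def[abs_def] o_def)
  qed
  have \<psi>': "(\<psi> has_field_derivative \<beta> * of_real (1 - (cmod w)\<^sup>2)) (at 0)"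
  proof -
    have eq: "of_real (1 - (cmod w)\<^sup>2) = 1 - cnj w * w"
      by (metis complex_norm_square mult.commute of_real_1 of_real_diff of_real_power)
    show ?thesis
      unfolding eq \<psi>_def Moebius_function_simple
      by (auto intro!: derivative_eq_intros simp: algebra_simps)
  qed
  define k where "k \<zeta> = F (\<alpha> * \<zeta>, \<psi> \<zeta>)" for \<zeta>
  have k': "(k has_field_derivative
      partial_z F (\<alpha> * \<zeta>) (\<psi> \<zeta>) * \<alpha> + partial_w F (\<alpha> * \<zeta>) (\<psi> \<zeta>) * d) (at \<zeta>)"
    if "\<zeta> \<in> unit_disk" and d: "(\<psi> has_field_derivative d) (at \<zeta>)" for \<zeta> d
  proof -
    have "((\<lambda>\<zeta>. (\<alpha> * \<zeta>, \<psi> \<zeta>)) has_derivative (\<lambda>h. (\<alpha> * h, d * h))) (at \<zeta>)"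
      using d by (auto intro!: derivative_eq_intros simp: has_field_derivative_def)
    from has_derivative_compose[OF this has_derivative_partials(1)[OF \<alpha>_in \<psi>_in]] that(1)
    have "((\<lambda>\<zeta>. F (\<alpha> * \<zeta>, \<psi> \<zeta>)) has_derivative (\<lambda>h. (partial_z F (\<alpha> * \<zeta>) (\<psi> \<zeta>) * \<alpha>
        + partial_w F (\<alpha> * \<zeta>) (\<psi> \<zeta>) * d) * h)) (at \<zeta>)"
      by (simp add: distrib_right mult.assoc)
    then show ?thesis
      unfolding k_def has_field_derivative_def .
  qed
  have k_hol: "k holomorphic_on unit_disk"
    using k' \<psi>_hol by (fastforce simp: holomorphic_on_open)
  have k_maps: "k ` unit_disk \<subseteq> unit_disk"
    using \<alpha>_in \<psi>_in maps by (force simp: k_def)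
  have k0: "k 0 = F (0, w)"
    by (simp add: k_def \<psi>0)
  have ext: "cmod p + (1 - (cmod w)\<^sup>2) * cmod q = 1 - (cmod (F (0, w)))\<^sup>2"
    using extremal_eq[of 0 w] w by (simp add: p_def q_def)
  \<comment> \<open>By the choice of \<alpha> and \<beta> both terms are nonnegative reals, and they
    add up to the left side of \<open>ext\<close>.\<close>
  have "deriv k 0 = \<alpha> * p + of_real (1 - (cmod w)\<^sup>2) * (\<beta> * q)"
    using DERIV_imp_deriv[OF k'[OF _ \<psi>']] by (simp add: \<psi>0 p_def q_def algebra_simps)
  also have "\<dots> = of_real (1 - (cmod (F (0, w)))\<^sup>2)"
    unfolding \<alpha>(2) \<beta>(2) ext[symmetric] by simp
  finally have "cmod (deriv k 0) = 1 - (cmod (k 0))\<^sup>2"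
    using norm_le_1[of 0 w] w unfolding k0 by (simp add: abs_square_le_1 del: of_real_diff)
  then obtain c where c: "cmod c = 1"
    "\<And>\<zeta>. \<zeta> \<in> unit_disk \<Longrightarrow> Moebius_function 0 (k 0) (k \<zeta>) = c * \<zeta>"
    using Schwarz_Pick_rigidity[OF k_hol k_maps] by blast
  \<comment> \<open>The zero of \<psi>: here the graph meets the second coordinate 0.\<close>
  define \<zeta> where "\<zeta> = - w / \<beta>"
  have \<zeta>: "cmod \<zeta> = cmod w"
    using \<beta> by (simp add: \<zeta>_def norm_divide)
  have "\<beta> \<noteq> 0"
    using \<beta> by auto
  then have "\<psi> \<zeta> = 0"
    by (simp add: \<psi>_def \<zeta>_def Moebius_function_eq_zero)
  then have "k \<zeta> = F (\<alpha> * \<zeta>, 0)"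
    by (simp add: k_def)
  moreover have "cmod (Moebius_function 0 (k 0) (k \<zeta>)) = cmod w"
    using c \<zeta> w by (simp add: norm_mult)
  moreover have "k 0 \<in> unit_disk" "k \<zeta> \<in> unit_disk"
    using k_maps w \<zeta> by (simp_all add: image_subset_iff)
  then have "0 < cmod (1 - cnj (k 0) * k \<zeta>)"
    using pseudo_hyperbolic_lt_1[of "k 0" "k \<zeta>"] by (smt (verit) mem_ball_0 norm_ge_zero)
  ultimately have "cmod (F (\<alpha> * \<zeta>, 0) - F (0, w))
      = cmod w * cmod (1 - cnj (F (0, w)) * F (\<alpha> * \<zeta>, 0))"
    by (simp add: Moebius_function_simple norm_divide k0 field_simps)
  then show thesis
    using that[of "\<alpha> * \<zeta>"] \<alpha> \<zeta> by (simp add: norm_mult)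
qed

section \<open>Slices over boundary points\<close>

text \<open>The slice is a uniform limit of the interior slices over the radial points
  \<open>s n\<close>, so it is holomorphic and the derivatives converge as well. The extremality
  equation at \<open>(s n, 0)\<close> then passes to the limit, where its first term
  vanishes.\<close>

lemma boundary_slice:
  assumes \<tau>: "\<tau> \<in> sphere 0 1"
  shows "(\<lambda>w. F (\<tau>, w)) holomorphic_on unit_disk"
    and "cmod (deriv (\<lambda>w. F (\<tau>, w)) 0) = 1 - (cmod (F (\<tau>, 0)))\<^sup>2"
proof -
  \<comment> \<open>The shift by 2 makes \<open>r 0 = 1 / 2\<close>, so that every
    \<open>r n\<close> is strictly positive.\<close>
  define r where "r n = 1 - 1 / real (n + 2)" for n
  define s where "s n = of_real (r n) * \<tau>" for n
  have r: "0 < r n" "r n < 1" for n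
    by (simp_all add: r_def)
  have r_lim: "r \<longlonglongrightarrow> 1"
  proof -
    have "(\<lambda>n. 1 / real (n + 2)) \<longlonglongrightarrow> 0"
      using LIMSEQ_ignore_initial_segment[OF lim_1_over_n, of 2] by simp
    then have "(\<lambda>n. 1 - 1 / real (n + 2)) \<longlonglongrightarrow> 1 - 0"
      by (intro tendsto_intros)
    then show ?thesis
      by (simp add: r_def[abs_def])
  qed
  have norm_s: "cmod (s n) = r n" for n
    using r[of n] \<tau> by (simp add: s_def norm_mult)
  then have s: "s n \<in> unit_disk" "s n \<in> cball 0 1" for n
    using r[of n] by auto
  have dist_s: "dist (s n) \<tau> = 1 - r n" for n
  proof -
    have "s n - \<tau> = of_real (r n - 1) * \<tau>"
      by (simp add: s_def algebra_simps)
    then show ?thesis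
      using \<tau> r[of n] by (simp add: dist_norm norm_mult del: of_real_diff)
  qed
  have s_lim: "s \<longlonglongrightarrow> \<tau>"
  proof -
    have "s \<longlonglongrightarrow> of_real 1 * \<tau>"
      unfolding s_def by (intro tendsto_intros r_lim)
    then show ?thesis
      by simp
  qed
  have ucont: "uniformly_continuous_on (cball 0 1 \<times> cball 0 1) F"
    by (intro compact_uniformly_continuous cont compact_Times compact_cball)
  have ulim: "uniform_limit (cball 0 1) (\<lambda>n w. F (s n, w)) (\<lambda>w. F (\<tau>, w)) sequentially"
    unfolding uniform_limit_iff
  proof (intro allI impI)
    fix e :: real assume "e > 0"
    then obtain d where "d > 0" and d: "\<And>x y. x \<in> cball 0 1 \<times> cball 0 1 \<Longrightarrow>
        y \<in> cball 0 1 \<times> cball 0 1 \<Longrightarrow> dist y x < d \<Longrightarrow> dist (F y) (F x) < e"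
      using ucont unfolding uniformly_continuous_on_def by metis
    have "\<forall>\<^sub>F n in sequentially. dist (s n) \<tau> < d"
      using s_lim \<open>d > 0\<close> by (rule tendstoD)
    then show "\<forall>\<^sub>F n in sequentially. \<forall>w\<in>cball 0 1. dist (F (s n, w)) (F (\<tau>, w)) < e"
    proof eventually_elim
      case (elim n)
      then show ?case
        using s \<tau> by (intro ballI d) (auto simp: dist_Pair_Pair)
    qed
  qed
  have "\<exists>g'. \<forall>x\<in>unit_disk. ((\<lambda>w. F (\<tau>, w)) has_field_derivative g' x) (at x) \<and>
      (\<lambda>n. partial_w F (s n) x) \<longlonglongrightarrow> g' x"
  proof (rule has_complex_derivative_uniform_sequence)
    show "((\<lambda>w. F (s n, w)) has_field_derivative partial_w F (s n) x) (at x)"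
      if "x \<in> unit_disk" for n x
      using has_derivative_partials(3) s that by blast
    show "\<exists>d>0. cball x d \<subseteq> unit_disk \<and>
        uniform_limit (cball x d) (\<lambda>n w. F (s n, w)) (\<lambda>w. F (\<tau>, w)) sequentially"
      if "x \<in> unit_disk" for x
    proof -
      obtain d where "d > 0" "cball x d \<subseteq> unit_disk"
        using \<open>x \<in> unit_disk\<close> open_contains_cball[of unit_disk] open_ball by blast
      moreover have "cball x d \<subseteq> cball 0 1"
        using \<open>cball x d \<subseteq> unit_disk\<close> ball_subset_cball by blast
      ultimately show ?thesis
        using uniform_limit_on_subset[OF ulim] by blast
    qed
  qed auto
  then obtain g' where g': "\<And>x. x \<in> unit_disk \<Longrightarrow> ((\<lambda>w. F (\<tau>, w)) has_field_derivative g' x) (at x)"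
    and g'_lim: "\<And>x. x \<in> unit_disk \<Longrightarrow> (\<lambda>n. partial_w F (s n) x) \<longlonglongrightarrow> g' x"
    by blast
  show "(\<lambda>w. F (\<tau>, w)) holomorphic_on unit_disk"
    using g' unfolding holomorphic_on_open[OF open_ball] by blast
  \<comment> \<open>The Cauchy estimate on the disc of radius \<open>1 - r n\<close> around \<open>s n\<close> bounds this quantity by twice
    the oscillation of \<open>F (_, 0)\<close> on that disc.\<close>
  have small: "(\<lambda>n. (1 - (cmod (s n))\<^sup>2) * cmod (partial_z F (s n) 0)) \<longlonglongrightarrow> 0"
  proof (rule tendstoI)
    fix e :: real assume "e > 0"
    define e' where "e' = e / 3"
    have "e' > 0"
      using \<open>e > 0\<close> by (simp add: e'_def)
    then obtain d where "d > 0" and d: "\<And>x. x \<in> cball 0 1 \<Longrightarrow> dist x \<tau> < d \<Longrightarrow>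
        dist (F (x, 0)) (F (\<tau>, 0)) < e'"
      using continuous_fst[of 0] \<tau> unfolding continuous_on_iff
      by (metis centre_in_cball dist_0_norm mem_cball mem_sphere order_refl zero_le_one)
    \<comment> \<open>The disc used below has radius \<open>dist (s n) \<tau>\<close>, so its points
      are within twice that distance of \<tau>, hence closer than \<open>d\<close>.\<close>
    have "\<forall>\<^sub>F n in sequentially. dist (s n) \<tau> < d / 2"
      using s_lim \<open>d > 0\<close> by (intro tendstoD) auto
    then show "\<forall>\<^sub>F n in sequentially.
        dist ((1 - (cmod (s n))\<^sup>2) * cmod (partial_z F (s n) 0)) 0 < e"
    proof eventually_elim
      case (elim n)
      define \<rho> where "\<rho> = 1 - r n"
      have \<rho>: "0 < \<rho>" "\<rho> < d / 2"
        using elim r[of n] by (auto simp: \<rho>_def dist_s)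
      have sub: "cball (s n) \<rho> \<subseteq> cball 0 1" "ball (s n) \<rho> \<subseteq> unit_disk"
        by (simp_all add: cball_subset_cball_iff ball_subset_ball_iff \<rho>_def norm_s)
      have "cmod ((deriv ^^ 1) (\<lambda>\<zeta>. F (\<zeta>, 0) - F (\<tau>, 0)) (s n)) \<le> fact 1 * e' / \<rho> ^ 1"
      proof (rule Cauchy_inequality)
        show "(\<lambda>\<zeta>. F (\<zeta>, 0) - F (\<tau>, 0)) holomorphic_on ball (s n) \<rho>"
          using holomorphic_on_subset[OF holomorphic_fst sub(2)] by (intro holomorphic_intros) auto
        show "continuous_on (cball (s n) \<rho>) (\<lambda>\<zeta>. F (\<zeta>, 0) - F (\<tau>, 0))"
          using continuous_on_subset[OF continuous_fst sub(1)] by (intro continuous_intros) auto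
        show "cmod (F (x, 0) - F (\<tau>, 0)) \<le> e'" if x: "cmod (s n - x) = \<rho>" for x
        proof -
          have "x \<in> cball 0 1"
            using sub(1) x by (auto simp: dist_norm)
          moreover have "dist x \<tau> < d"
            using dist_triangle[of x \<tau> "s n"] dist_s[of n] x \<rho>
            by (simp add: dist_norm[of "s n" x, symmetric] \<rho>_def dist_commute[of x "s n"])
          ultimately show ?thesis
            using d by (force simp: dist_norm)
        qed
      qed (use \<rho> in auto)
      moreover have "deriv (\<lambda>\<zeta>. F (\<zeta>, 0) - F (\<tau>, 0)) (s n) = partial_z F (s n) 0"
        using DERIV_diff[OF has_derivative_partials(2)[OF s(1)] DERIV_const]
        by (intro DERIV_imp_deriv) auto
      ultimately have bound: "\<rho> * cmod (partial_z F (s n) 0) \<le> e'"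
        using \<rho> by (simp add: field_simps)
      \<comment> \<open>One factor of the weight is \<rho>, which cancels the
        \<open>1 / \<rho>\<close> of the Cauchy estimate; the other is at most 2.\<close>
      have "1 - (r n)\<^sup>2 = (1 + r n) * \<rho>"
        by (simp add: \<rho>_def power2_eq_square algebra_simps)
      then have "(1 - (cmod (s n))\<^sup>2) * cmod (partial_z F (s n) 0)
          = (1 + r n) * (\<rho> * cmod (partial_z F (s n) 0))"
        by (simp add: norm_s)
      also have "\<dots> \<le> 2 * e'"
        using r[of n] \<rho> bound by (intro mult_mono) auto
      also have "\<dots> < e"
        using \<open>e > 0\<close> by (simp add: e'_def)
      finally have "(1 - (cmod (s n))\<^sup>2) * cmod (partial_z F (s n) 0) < e" .
      moreover have "0 \<le> 1 - (cmod (s n))\<^sup>2"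
        using s(1)[of n] by (simp add: abs_square_le_1)
      ultimately show ?case
        by simp
    qed
  qed
  have F_lim: "(\<lambda>n. F (s n, 0)) \<longlonglongrightarrow> F (\<tau>, 0)"
    using tendsto_uniform_limitI[OF ulim] by simp
  have "(\<lambda>n. cmod (partial_w F (s n) 0)) \<longlonglongrightarrow> cmod (g' 0)"
    by (intro tendsto_norm g'_lim) simp
  moreover have "cmod (partial_w F (s n) 0)
      = 1 - (cmod (F (s n, 0)))\<^sup>2 - (1 - (cmod (s n))\<^sup>2) * cmod (partial_z F (s n) 0)" for n
    using extremal_eq[OF s(1), of 0 n] by simp
  moreover have "(\<lambda>n. 1 - (cmod (F (s n, 0)))\<^sup>2 - (1 - (cmod (s n))\<^sup>2) * cmod (partial_z F (s n) 0))
      \<longlonglongrightarrow> 1 - (cmod (F (\<tau>, 0)))\<^sup>2 - 0"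
    by (intro tendsto_diff small tendsto_intros F_lim)
  ultimately have "cmod (g' 0) = 1 - (cmod (F (\<tau>, 0)))\<^sup>2"
    using LIMSEQ_unique by fastforce
  moreover have "deriv (\<lambda>w. F (\<tau>, w)) 0 = g' 0"
    using g' by (intro DERIV_imp_deriv) auto
  ultimately show "cmod (deriv (\<lambda>w. F (\<tau>, w)) 0) = 1 - (cmod (F (\<tau>, 0)))\<^sup>2"
    by simp
qed

text \<open>A unimodular value inside the disk is an interior maximum of the modulus; continuity
  carries the resulting constancy to the closed disk.\<close>

lemma boundary_slice_constant:
  assumes \<tau>: "\<tau> \<in> sphere 0 1" and a: "a \<in> unit_disk" "cmod (F (\<tau>, a)) = 1"
    and w: "w \<in> cball 0 1"
  shows "F (\<tau>, w) = F (\<tau>, 0)"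
proof -
  have "(\<lambda>w. F (\<tau>, w)) constant_on unit_disk"
    by (rule maximum_modulus_principle[OF boundary_slice(1)[OF \<tau>], where U = unit_disk and \<xi> = a])
      (use a \<tau> norm_le_1 in auto)
  then have "(\<lambda>w. F (\<tau>, w)) constant_on closure unit_disk"
    using continuous_snd[of \<tau>] \<tau> by (intro constant_on_closureI) auto
  then show ?thesis
    using w by (auto simp: constant_on_def)
qed

text \<open>A unimodular interior value would make the slice a unimodular constant, against
  \<open>lt\<close>. So the slice is a self-map of the disk with Schwarz--Pick equality at 0, hence
  an automorphism, and compactness of the image adds the boundary values.\<close>

lemma boundary_slice_surj:
  assumes \<tau>: "\<tau> \<in> sphere 0 1" and lt: "cmod (F (\<tau>, 0)) < 1"
  shows "cball 0 1 \<subseteq> (\<lambda>w. F (\<tau>, w)) ` cball 0 1"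
proof -
  let ?g = "\<lambda>w. F (\<tau>, w)"
  have "?g ` unit_disk \<subseteq> unit_disk"
  proof (rule image_subsetI, rule ccontr)
    fix a assume "a \<in> unit_disk" "F (\<tau>, a) \<notin> unit_disk"
    moreover from this have "cmod (F (\<tau>, a)) = 1"
      using norm_le_1[of \<tau> a] \<tau> by auto
    ultimately show False
      using boundary_slice_constant[OF \<tau>, of a a] lt by simp
  qed
  then have "disk_automorphism ?g"
    using boundary_slice[OF \<tau>] by (intro disk_automorphismI)
  then have "?g ` unit_disk = unit_disk"
    by (auto simp: disk_automorphism_def bij_betw_def)
  then have "unit_disk \<subseteq> ?g ` cball 0 1"
    using ball_subset_cball by blast
  moreover have "closed (?g ` cball 0 1)"
    using continuous_snd[of \<tau>] \<tau> by (intro compact_imp_closed compact_continuous_image) auto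
  ultimately have "closure unit_disk \<subseteq> ?g ` cball 0 1"
    by (rule closure_minimal)
  then show ?thesis
    by simp
qed

text \<open>The strict inequality is only an open condition on \<tau>. Attaining both 1 and -1 is
  equivalent to it on the circle and is closed, so connectedness applies.\<close>

lemma boundary_dichotomy:
  "(\<forall>\<tau>\<in>sphere 0 1. cmod (F (\<tau>, 0)) = 1) \<or> (\<forall>\<tau>\<in>sphere 0 1. cmod (F (\<tau>, 0)) < 1)"
proof -
  define A where "A = {\<tau> \<in> sphere 0 1. cmod (F (\<tau>, 0)) = 1}"
  \<comment> \<open>\<open>B c\<close> collects the \<tau> whose slice attains \<open>c\<close>; it
    is closed as a projection of a compact set. Two values of \<open>c\<close> are needed because a
    constant slice may attain one.\<close>
  define B where "B c = fst ` {p \<in> sphere 0 1 \<times> cball 0 1. F p = c}" for c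
  have "continuous_on (sphere 0 1) (\<lambda>\<tau>. cmod (F (\<tau>, 0)))"
    using continuous_on_subset[OF continuous_fst sphere_cball] by (intro continuous_intros) auto
  then have "closed A"
    unfolding A_def by (intro continuous_closed_preimage_constant) auto
  have "closed (B c)" for c
  proof -
    have "continuous_on (sphere 0 1 \<times> cball 0 1) F"
      by (rule continuous_on_subset[OF cont]) auto
    then have "closed {p \<in> sphere 0 1 \<times> cball 0 1. F p = c}"
      by (intro continuous_closed_preimage_constant closed_Times) auto
    then have "compact ((sphere 0 1 \<times> cball 0 1) \<inter> {p \<in> sphere 0 1 \<times> cball 0 1. F p = c})"
      by (intro compact_Int_closed compact_Times) auto
    then have "compact {p \<in> sphere 0 1 \<times> cball 0 1. F p = c}"
      by (simp add: Int_def conj_ac)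
    then show ?thesis
      unfolding B_def by (intro compact_imp_closed compact_continuous_image continuous_intros)
  qed
  then have "closed (B 1 \<inter> B (-1))"
    by blast
  have disj: "A \<inter> (B 1 \<inter> B (-1)) = {}"
  proof -
    have "F (\<tau>, 0) = c" if "\<tau> \<in> A" "\<tau> \<in> B c" for \<tau> c
    proof -
      obtain w where "w \<in> cball 0 1" "F (\<tau>, w) = c"
        using \<open>\<tau> \<in> B c\<close> by (auto simp: B_def)
      then show ?thesis
        using boundary_slice_constant[of \<tau> 0 w] \<open>\<tau> \<in> A\<close> by (simp add: A_def)
    qed
    then have "c = d" if "\<tau> \<in> A" "\<tau> \<in> B c" "\<tau> \<in> B d" for \<tau> c d
      using that by metis
    from this[of _ 1 "-1"] show ?thesis
      by auto
  qed
  have B: "\<tau> \<in> B 1 \<inter> B (-1)" if \<tau>: "\<tau> \<in> sphere 0 1" and "\<tau> \<notin> A" for \<tau>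
  proof -
    have "cmod (F (\<tau>, 0)) < 1"
      using norm_le_1[of \<tau> 0] that by (auto simp: A_def)
    from boundary_slice_surj[OF \<tau> this] have "\<tau> \<in> B c" if "c \<in> cball 0 1" for c
      using \<tau> that by (force simp: B_def)
    then show ?thesis
      by auto
  qed
  have "connected (sphere (0::complex) 1)"
    by (simp add: connected_sphere_eq)
  then have "A \<inter> sphere 0 1 = {} \<or> (B 1 \<inter> B (-1)) \<inter> sphere 0 1 = {}"
    using B disj \<open>closed A\<close> \<open>closed (B 1 \<inter> B (-1))\<close>
    by (intro connected_closedD) blast+
  then show ?thesis
  proof
    assume "A \<inter> sphere 0 1 = {}"
    then have "cmod (F (\<tau>, 0)) < 1" if "\<tau> \<in> sphere 0 1" for \<tau>
      using norm_le_1[of \<tau> 0] that by (force simp: A_def)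
    then show ?thesis
      by blast
  next
    assume "(B 1 \<inter> B (-1)) \<inter> sphere 0 1 = {}"
    then have "sphere 0 1 \<subseteq> A"
      using B by blast
    then show ?thesis
      by (auto simp: A_def)
  qed
qed

section \<open>The two alternatives for the boundary slices\<close>

text \<open>All boundary slices are constant, so \<open>F (z, w) - F (z, 0)\<close> vanishes for
  \<open>z\<close> on the circle, hence in the disk by the maximum principle. The
  \<open>w\<close>-partial is then 0, and extremality at the origin is Schwarz--Pick equality for
  \<open>F (_, 0)\<close>.\<close>

lemma boundary_unimodular_imp_automorphism:
  assumes uni: "\<forall>\<tau>\<in>sphere 0 1. cmod (F (\<tau>, 0)) = 1"
  shows "\<exists>\<phi>. disk_automorphism \<phi> \<and> (\<forall>z\<in>unit_disk. \<forall>w\<in>unit_disk. F (z, w) = \<phi> z)"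
proof -
  have indep: "F (z, w) = F (z, 0)" if z: "z \<in> unit_disk" and w: "w \<in> unit_disk" for z w
  proof -
    have "cmod (F (z, w) - F (z, 0)) \<le> 0"
    proof (rule maximum_modulus_frontier[where f = "\<lambda>z. F (z, w) - F (z, 0)"])
      show "(\<lambda>z. F (z, w) - F (z, 0)) holomorphic_on interior unit_disk"
        using holomorphic_on_diff[OF holomorphic_fst[OF w] holomorphic_fst[of 0]] by simp
      show "continuous_on (closure unit_disk) (\<lambda>z. F (z, w) - F (z, 0))"
        using continuous_on_diff[OF continuous_fst[of w] continuous_fst[of 0]] w by simp
      show "cmod (F (\<tau>, w) - F (\<tau>, 0)) \<le> 0" if "\<tau> \<in> frontier unit_disk" for \<tau>
        using boundary_slice_constant[of \<tau> 0 w] uni that w by simp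
    qed (use z in auto)
    then show ?thesis
      by simp
  qed
  have "partial_w F 0 0 = 0"
  proof -
    have "((\<lambda>w. F (0, w)) has_field_derivative 0) (at 0)"
    proof (rule has_field_derivative_transform_within_open)
      show "F (0, 0) = F (0, w)" if "w \<in> unit_disk" for w
        using indep[of 0 w] that by simp
    qed auto
    then show ?thesis
      by (simp add: partial_w_def DERIV_imp_deriv)
  qed
  then have "cmod (deriv (\<lambda>z. F (z, 0)) 0) = 1 - (cmod (F (0, 0)))\<^sup>2"
    using extremal_eq[of 0 0] by (simp add: partial_z_def)
  then have "disk_automorphism (\<lambda>z. F (z, 0))"
    using maps by (intro disk_automorphismI holomorphic_fst) auto
  then show ?thesis
    using indep by blast
qed

text \<open>The hypotheses are asymmetric because \<open>w\<close> is sent to the chosen point 1,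
  whereas the limit of the matching points \<open>z\<close> can be anywhere on the circle.\<close>

lemma not_both_boundaries_interior:
  assumes 1: "\<forall>\<tau>\<in>sphere 0 1. cmod (F (\<tau>, 0)) < 1" and 2: "cmod (F (0, 1)) < 1"
  shows False
proof -
  define u where "u n = complex_of_real (1 - 1 / real (Suc n))" for n
  have norm_u: "cmod (u n) = 1 - 1 / real (Suc n)" for n
    by (simp add: u_def del: of_real_diff of_nat_Suc)
  then have u: "u n \<in> unit_disk" for n
    by simp
  have "\<forall>n. \<exists>z. cmod z = cmod (u n) \<and>
      cmod (F (z, 0) - F (0, u n)) = cmod (u n) * cmod (1 - cnj (F (0, u n)) * F (z, 0))"
    using exists_isometric_pair[OF u] by metis
  then obtain z where norm_z: "\<And>n. cmod (z n) = cmod (u n)"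
    and eq: "\<And>n. cmod (F (z n, 0) - F (0, u n))
      = cmod (u n) * cmod (1 - cnj (F (0, u n)) * F (z n, 0))"
    by metis
  have lim: "(\<lambda>n. 1 - 1 / real (Suc n)) \<longlonglongrightarrow> 1"
    using tendsto_diff[OF tendsto_const[of 1] LIMSEQ_Suc[OF lim_1_over_n]] by simp
  have z: "z n \<in> cball 0 1" for n
    using norm_z[of n] u[of n] by auto
  \<comment> \<open>Only the moduli of the \<open>z n\<close> are known, so a limit is available
    only along a subsequence.\<close>
  then obtain \<tau> q where \<tau>: "\<tau> \<in> cball 0 1" and q: "strict_mono q" and z_lim: "(z \<circ> q) \<longlonglongrightarrow> \<tau>"
    using compact_cball[of "0::complex" 1] unfolding compact_def by metis
  have u_lim: "(u \<circ> q) \<longlonglongrightarrow> 1"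
    using LIMSEQ_subseq_LIMSEQ[OF tendsto_of_real[OF lim] q] by (simp add: u_def o_def del: of_real_diff of_nat_Suc)
  have norm_lim: "(\<lambda>n. cmod (u (q n))) \<longlonglongrightarrow> 1"
    using tendsto_norm[OF u_lim] by simp
  have "cmod \<tau> = 1"
    using tendsto_norm[OF z_lim] norm_lim by (auto simp: o_def norm_z intro: LIMSEQ_unique)
  then have \<tau>1: "cmod (F (\<tau>, 0)) < 1"
    using 1 by simp
  have Fz: "(\<lambda>n. F (z (q n), 0)) \<longlonglongrightarrow> F (\<tau>, 0)"
    using continuous_on_tendsto_compose[OF continuous_fst[of 0] z_lim] \<tau> z by (simp add: o_def)
  have Fu: "(\<lambda>n. F (0, u (q n))) \<longlonglongrightarrow> F (0, 1)"
    using continuous_on_tendsto_compose[OF continuous_snd[of 0] u_lim] u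
    by (simp add: o_def less_imp_le)
  have "(\<lambda>n. cmod (F (z (q n), 0) - F (0, u (q n)))) \<longlonglongrightarrow> cmod (F (\<tau>, 0) - F (0, 1))"
    by (intro tendsto_intros Fz Fu)
  moreover have "(\<lambda>n. cmod (u (q n)) * cmod (1 - cnj (F (0, u (q n))) * F (z (q n), 0)))
      \<longlonglongrightarrow> 1 * cmod (1 - cnj (F (0, 1)) * F (\<tau>, 0))"
    by (intro tendsto_intros norm_lim Fz Fu)
  \<comment> \<open>In the limit two points of the open disk would have pseudo-hyperbolic distance
    1.\<close>
  ultimately have "cmod (F (\<tau>, 0) - F (0, 1)) = cmod (1 - cnj (F (0, 1)) * F (\<tau>, 0))"
    using LIMSEQ_unique by (fastforce simp: eq)
  then show False
    using pseudo_hyperbolic_lt_1[OF 2 \<tau>1] by simp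
qed

section \<open>Exchange of the variables and conclusion\<close>

lemma continuous_extremal_swap: "continuous_extremal (F \<circ> prod.swap)"
proof
  show "(F \<circ> prod.swap) holomorphic2_on bidisk"
    unfolding holomorphic2_on_def
  proof
    fix p assume p: "p \<in> bidisk"
    then obtain z w where zw: "p = (z, w)" "z \<in> unit_disk" "w \<in> unit_disk"
      by auto
    have "(prod.swap has_derivative prod.swap) (at p within bidisk)"
      unfolding prod.swap_def by (auto intro!: derivative_eq_intros)
    moreover have "(F has_derivative (\<lambda>h. partial_z F w z * fst h + partial_w F w z * snd h))
        (at (prod.swap p))"
      using has_derivative_partials(1) zw by simp
    ultimately have "((\<lambda>x. F (prod.swap x)) has_derivative
        (\<lambda>h. partial_z F w z * fst (prod.swap h) + partial_w F w z * snd (prod.swap h)))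
        (at p within bidisk)"
      by (rule has_derivative_compose)
    then have "((F \<circ> prod.swap) has_derivative
        (\<lambda>h. partial_w F w z * fst h + partial_z F w z * snd h)) (at p within bidisk)"
      by (simp add: o_def add.commute)
    then show "\<exists>a b. ((F \<circ> prod.swap) has_derivative (\<lambda>h. a * fst h + b * snd h))
        (at p within bidisk)"
      by blast
  qed
  show "(F \<circ> prod.swap) ` bidisk \<subseteq> unit_disk"
    using maps by auto
  show "everywhere_inf_extremal (F \<circ> prod.swap)"
    unfolding everywhere_inf_extremal_def
  proof (intro ballI)
    fix z w assume "z \<in> unit_disk" "w \<in> unit_disk"
    then show "(1 - (cmod z)\<^sup>2) * cmod (partial_z (F \<circ> prod.swap) z w)
        + (1 - (cmod w)\<^sup>2) * cmod (partial_w (F \<circ> prod.swap) z w)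
        = 1 - (cmod ((F \<circ> prod.swap) (z, w)))\<^sup>2"
      using extremal_eq[of w z] by (simp add: partial_z_def partial_w_def add.commute)
  qed
  show "continuous_on (cball 0 1 \<times> cball 0 1) (F \<circ> prod.swap)"
    by (intro continuous_on_compose continuous_on_swap) (simp add: product_swap cont)
qed

theorem depends_on_one_variable:
  "\<exists>\<phi>. disk_automorphism \<phi> \<and>
    ((\<forall>z\<in>unit_disk. \<forall>w\<in>unit_disk. F (z, w) = \<phi> z) \<or>
     (\<forall>z\<in>unit_disk. \<forall>w\<in>unit_disk. F (z, w) = \<phi> w))"
proof -
  interpret swap: continuous_extremal "F \<circ> prod.swap"
    by (rule continuous_extremal_swap)
  \<comment> \<open>Of the strict alternative for the exchanged function only its instance at 1 is
    kept, which is a bound on \<open>F (0, 1)\<close>.\<close>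
  consider "\<forall>\<tau>\<in>sphere 0 1. cmod (F (\<tau>, 0)) = 1"
    | "\<forall>\<tau>\<in>sphere 0 1. cmod ((F \<circ> prod.swap) (\<tau>, 0)) = 1"
    | "\<forall>\<tau>\<in>sphere 0 1. cmod (F (\<tau>, 0)) < 1" "cmod (F (0, 1)) < 1"
    using boundary_dichotomy swap.boundary_dichotomy by fastforce
  then show ?thesis
  proof cases
    case 1
    then show ?thesis
      using boundary_unimodular_imp_automorphism by blast
  next
    case 2
    then show ?thesis
      using swap.boundary_unimodular_imp_automorphism by auto
  next
    case 3
    then show ?thesis
      using not_both_boundaries_interior by blast
  qed
qed

end

section \<open>Passage from the function to its extension\<close>

theorem mainTheorem5:
  fixes f :: "complex \<times> complex \<Rightarrow> complex"
  assumes "f holomorphic2_on bidisk"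
    and "f ` bidisk \<subseteq> unit_disk"
    and "everywhere_inf_extremal f"
    and "\<exists>F. continuous_on (cball 0 1 \<times> cball 0 1) F \<and> (\<forall>p\<in>bidisk. F p = f p)"
  shows "\<exists>\<phi>. disk_automorphism \<phi> \<and>
           ((\<forall>z\<in>unit_disk. \<forall>w\<in>unit_disk. f (z, w) = \<phi> z) \<or>
            (\<forall>z\<in>unit_disk. \<forall>w\<in>unit_disk. f (z, w) = \<phi> w))"
proof -
  obtain F where cont: "continuous_on (cball 0 1 \<times> cball 0 1) F"
    and eq: "\<And>p. p \<in> bidisk \<Longrightarrow> F p = f p"
    using assms(4) by blast
  \<comment> \<open>A derivative depends only on values near the point, and \<open>F\<close> and
    \<open>f\<close> agree on an open set.\<close>
  have part: "partial_z F z w = partial_z f z w" "partial_w F z w = partial_w f z w"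
    if "z \<in> unit_disk" "w \<in> unit_disk" for z w
  proof -
    have "\<forall>\<^sub>F \<zeta> in nhds z. \<zeta> \<in> unit_disk" "\<forall>\<^sub>F \<zeta> in nhds w. \<zeta> \<in> unit_disk"
      by (intro eventually_nhds_in_open open_ball that)+
    then have "\<forall>\<^sub>F \<zeta> in nhds z. F (\<zeta>, w) = f (\<zeta>, w)" "\<forall>\<^sub>F \<zeta> in nhds w. F (z, \<zeta>) = f (z, \<zeta>)"
      by (auto elim!: eventually_mono simp del: mem_ball_0 intro!: eq that)
    then show "partial_z F z w = partial_z f z w" "partial_w F z w = partial_w f z w"
      unfolding partial_z_def partial_w_def by (auto intro!: deriv_cong_ev)
  qed
  \<comment> \<open>The values of \<open>f\<close> outside the bidisk are arbitrary, so the locale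
    is instantiated with \<open>F\<close>.\<close>
  interpret continuous_extremal F
  proof
    show "F holomorphic2_on bidisk"
      unfolding holomorphic2_on_def
    proof
      fix p assume p: "p \<in> bidisk"
      then obtain a b where "(f has_derivative (\<lambda>h. a * fst h + b * snd h)) (at p within bidisk)"
        using assms(1) unfolding holomorphic2_on_def by blast
      then have "(F has_derivative (\<lambda>h. a * fst h + b * snd h)) (at p within bidisk)"
        using eq by (rule has_derivative_transform[OF p, rotated])
      then show "\<exists>a b. (F has_derivative (\<lambda>h. a * fst h + b * snd h)) (at p within bidisk)"
        by blast
    qed
    show "F ` bidisk \<subseteq> unit_disk"
      using assms(2) eq by (simp add: image_subset_iff)
    show "everywhere_inf_extremal F"
      using assms(3) part eq by (simp add: everywhere_inf_extremal_def)
  qed (rule cont)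
  show ?thesis
    using depends_on_one_variable eq by simp
qed

end
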